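(* Let $\mathbf{X}$ be a random element in a strictly convex separable (real) Hilbert space $\mathcal{X}$ with norm $\|\cdot\|$, and suppose that the distribution of $\mathbf{X}$ is nonatomic and not entirely supported on a line in $\mathcal{X}$. Assume also that for every $R>0$, $$\sup_{\|\mathbf{x}\|\le R} E\left\{\|\mathbf{x}-\mathbf{X}\|^{-1}\right\} < \infty .$$ Let $\mathbf{X}_1,\mathbf{X}_2,\ldots$ be i.i.d. observations from the distribution of $\mathbf{X}$, let $\mathbf{m}_s$ be the spatial median of $\mathbf{X}$, and let $\widehat{\mathbf{m}}_s$ be the empirical spatial median based on $\mathbf{X}_1,\ldots,\mathbf{X}_n$. Then $\|\widehat{\mathbf{m}}_s - \mathbf{m}_s\| \to 0$ as $n\to\infty$ almost surely.
   Context: The spatial median $\mathbf{m}_s$ of $\mathbf{X}$ is the minimizer over $\mathbf{x}\in\mathcal{X}$ of $g(\mathbf{x}) = E\{\|\mathbf{x}-\mathbf{X}\| - \|\mathbf{X}\|\}$; it is unique when the distribution of $\mathbf{X}$ is not entirely supported on a line. The empirical spatial median $\widehat{\mathbf{m}}_s$ (depending on $n$) is a minimizer over $\mathbf{x}\in\mathcal{X}$ of $n^{-1}\sum_{i=1}^{n}\|\mathbf{x}-\mathbf{X}_i\|$; it is unique when $\mathbf{X}_1,\ldots,\mathbf{X}_n$ do not all lie on a line. "Nonatomic" means $P(\mathbf{X}=\mathbf{x})=0$ for every $\mathbf{x}\in\mathcal{X}$. *)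

theory Defs
  imports "HOL-Probability.Probability"
begin

definition is_line :: "'a::real_vector set \<Rightarrow> bool" where
  "is_line L \<longleftrightarrow> (\<exists>a v. v \<noteq> 0 \<and> L = range (\<lambda>t::real. a + t *\<^sub>R v))"

text \<open>The integrand is bounded by \<open>norm x\<close>, so the Bochner integral below is the
  expectation without any moment assumption on \<open>X\<close>.\<close>

definition is_spatial_median :: "'w measure \<Rightarrow> ('w \<Rightarrow> 'a::real_normed_vector) \<Rightarrow> 'a \<Rightarrow> bool" where
  "is_spatial_median M X m \<longleftrightarrow>
     is_arg_min (\<lambda>x. \<integral>\<omega>. (norm (x - X \<omega>) - norm (X \<omega>)) \<partial>M) (\<lambda>x. True) m"

definition is_empirical_spatial_median :: "nat \<Rightarrow> (nat \<Rightarrow> 'a::real_normed_vector) \<Rightarrow> 'a \<Rightarrow> bool" where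
  "is_empirical_spatial_median n xs m \<longleftrightarrow>
     is_arg_min (\<lambda>x. (\<Sum>i<n. norm (x - xs i)) / real n) (\<lambda>x. True) m"

text \<open>Every inner product space is strictly convex, so strict convexity of a Hilbert space
  needs no separate hypothesis.\<close>

lemma real_inner_strictly_convex:
  fixes x y :: "'a::real_inner"
  assumes "norm x = 1" and "norm y = 1" and "x \<noteq> y"
  shows "norm ((1/2) *\<^sub>R (x + y)) < 1"
proof -
  have "(norm (x + y))\<^sup>2 + (norm (x - y))\<^sup>2 = 2 * (norm x)\<^sup>2 + 2 * (norm y)\<^sup>2"
    by (simp add: power2_norm_eq_inner algebra_simps inner_commute)
  moreover have "(norm (x - y))\<^sup>2 > 0"
    using assms(3) by simp
  ultimately have "(norm (x + y))\<^sup>2 < 2\<^sup>2"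
    unfolding assms(1,2) power_one power2_eq_square[of 2] by linarith
  hence "norm (x + y) < 2"
    by (rule power_less_imp_less_base) simp
  thus ?thesis by simp
qed

end

theory Submission
  imports Defs
begin

text \<open>The law of large numbers holds uniformly over a bounded family of functions with a common
  Lipschitz constant: on a separable space the identity is approximated by simple functions, which
  reduces the claim to countably many bounded real variables. The functions
  \<open>x \<mapsto> norm (m + h - x) - norm (m - x)\<close> with \<open>norm h = e\<close> form such a family, so no compactness of
  the sphere is needed. By convexity of the empirical objective it remains to bound
  \<open>g (m + h) - g m\<close> away from \<open>0\<close> on that sphere. If this fails along \<open>h k\<close>, then, since
  \<open>g (m + h k / 2) \<ge> g m\<close>, the nonnegative gaps
  \<open>norm a + norm (a + h k) - norm (2 a + h k)\<close> with \<open>a = m - X\<close> tend to \<open>0\<close> in mean, hence almost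
  surely along a subsequence. Thus \<open>h k\<close> approaches the line spanned by \<open>a\<close> for almost every value
  of \<open>a\<close>; two linearly independent values force \<open>h k\<close> to tend to \<open>0\<close>.\<close>

section \<open>A strong law of large numbers, uniform over Lipschitz families\<close>

text \<open>The exceptional null set may depend on \<open>e\<close>; passing to the countably many
  radii \<open>inverse (real (Suc k))\<close> merges these sets into one.\<close>

lemma AE_tendstoI:
  fixes f :: "nat \<Rightarrow> 'a \<Rightarrow> 'b::metric_space"
  assumes "\<And>e::real. e > 0 \<Longrightarrow> AE \<omega> in M. \<forall>\<^sub>F n in sequentially. dist (f n \<omega>) (l \<omega>) < e"
  shows "AE \<omega> in M. (\<lambda>n. f n \<omega>) \<longlonglongrightarrow> l \<omega>"
proof -
  have "AE \<omega> in M. \<forall>k. \<forall>\<^sub>F n in sequentially. dist (f n \<omega>) (l \<omega>) < inverse (real (Suc k))"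
    unfolding AE_all_countable by (intro allI assms) simp
  then show ?thesis
  proof eventually_elim
    case (elim \<omega>)
    show ?case
    proof (rule tendstoI)
      fix e :: real assume "e > 0"
      then obtain k where k: "inverse (real (Suc k)) < e"
        using reals_Archimedean by blast
      from elim[rule_format, of k] show "\<forall>\<^sub>F n in sequentially. dist (f n \<omega>) (l \<omega>) < e"
        by (rule eventually_mono) (use k in linarith)
    qed
  qed
qed

text \<open>Boundedness makes Hoeffding's inequality available: the probabilities of a deviation by
  \<open>e\<close> decay geometrically, so they are summable, and Borel-Cantelli applies.\<close>

lemma (in prob_space) strong_law_of_large_numbers_bounded:
  fixes Xs :: "nat \<Rightarrow> 'a \<Rightarrow> 'b::topological_space" and \<phi> :: "'b \<Rightarrow> real"
  assumes indep: "indep_vars (\<lambda>_. borel) Xs UNIV"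
    and distr: "\<And>i. distr M borel (Xs i) = D"
    and \<phi> [measurable]: "\<phi> \<in> borel_measurable borel"
    and bound: "\<And>x. \<bar>\<phi> x\<bar> \<le> B"
  shows "AE \<omega> in M. (\<lambda>n. (\<Sum>i<n. \<phi> (Xs i \<omega>)) / real n) \<longlonglongrightarrow> (\<integral>x. \<phi> x \<partial>D)"
proof -
  have rv [measurable]: "Xs i \<in> borel_measurable M" for i
    using indep unfolding indep_vars_def by auto
  have B: "0 \<le> B"
    using bound[of undefined] by linarith
  define \<mu> where "\<mu> = (\<integral>x. \<phi> x \<partial>D)"
  have \<mu>: "\<mu> = expectation (\<lambda>\<omega>. \<phi> (Xs 0 \<omega>))"
    unfolding \<mu>_def distr[of 0, symmetric] by (rule integral_distr) auto
  have dev: "AE \<omega> in M. \<forall>\<^sub>F n in sequentially. \<bar>(\<Sum>i<n. \<phi> (Xs i \<omega>)) / real n - \<mu>\<bar> < e"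
    if e: "e > 0" for e :: real
  proof -
    define A where "A n = {\<omega> \<in> space M. \<bar>(\<Sum>i<n. \<phi> (Xs i \<omega>)) / real n - \<mu>\<bar> \<ge> e}" for n
    \<comment> \<open>Hoeffding's bound is \<open>2 * q ^ n\<close>. The values are placed in an
      interval of half-width \<open>B + 1\<close> rather than \<open>B\<close>, so that its length
      is positive and \<open>q < 1\<close> even when \<open>B = 0\<close>.\<close>
    define q where "q = exp (- 2 * e\<^sup>2 / (2 * (B + 1))\<^sup>2)"
    have q: "0 < q" "q < 1"
      using e B by (auto simp: q_def)
    have A_le: "prob (A n) \<le> 2 * q ^ n" if "n \<ge> 1" for n
    proof -
      interpret Hoeffding_ineq_iid M "{..<n}" "\<lambda>i \<omega>. \<phi> (Xs i \<omega>)" "\<lambda>\<omega>. \<phi> (Xs 0 \<omega>)"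
        "- (B + 1)" "B + 1" \<mu>
      proof unfold_locales
        have "indep_vars (\<lambda>_. borel) Xs {..<n}"
          using indep by (rule indep_vars_subset) auto
        then show "indep_vars (\<lambda>_. borel) (\<lambda>i \<omega>. \<phi> (Xs i \<omega>)) {..<n}"
          by (rule indep_vars_compose2) auto
        fix i
        have "distr M borel (\<lambda>\<omega>. \<phi> (Xs j \<omega>)) = distr D borel \<phi>" for j
          unfolding distr[of j, symmetric] by (subst distr_distr) (auto simp: comp_def)
        then show "distr M borel (\<lambda>\<omega>. \<phi> (Xs i \<omega>)) = distr M borel (\<lambda>\<omega>. \<phi> (Xs 0 \<omega>))"
          by simp
      next
        have "\<phi> x \<in> {- (B + 1)..B + 1}" for x
          using bound[of x] by auto
        then show "AE \<omega> in M. \<phi> (Xs 0 \<omega>) \<in> {- (B + 1)..B + 1}"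
          by simp
      qed (auto simp: \<mu>)
      have "prob (A n) \<le> 2 * exp (- 2 * real n * e\<^sup>2 / (2 * (B + 1))\<^sup>2)"
        using Hoeffding_ineq_abs_ge'[of e] e B that
        by (auto simp: A_def lessThan_empty_iff)
      also have "exp (- 2 * real n * e\<^sup>2 / (2 * (B + 1))\<^sup>2) = q ^ n"
        by (simp add: q_def exp_of_nat_mult [symmetric])
      finally show ?thesis .
    qed
    have "summable (\<lambda>n. prob (A n))"
    proof (rule summable_comparison_test'[where N = 1])
      show "summable (\<lambda>n. 2 * q ^ n)"
        using q by (intro summable_mult summable_geometric) auto
    qed (use A_le in auto)
    then have "AE \<omega> in M. \<forall>\<^sub>F n in sequentially. \<omega> \<in> space M - A n"
      by (intro borel_cantelli_AE1) (auto simp: A_def less_top[symmetric])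
    then show ?thesis
      by eventually_elim (auto elim!: eventually_mono simp: A_def not_le)
  qed
  show ?thesis
    unfolding \<mu>_def[symmetric] by (rule AE_tendstoI) (simp add: dist_real_def dev)
qed

text \<open>Composed with a simple function \<open>S k\<close> close to the identity, every member
  of \<open>F\<close> becomes a combination of the same finitely many indicators with coefficients
  bounded by \<open>B\<close>. Boundedness and the Lipschitz condition control the replacement error
  uniformly, so one random quantity \<open>E k n\<close>, free of \<open>f\<close>, dominates all
  deviations.\<close>

lemma (in prob_space) uniform_law_of_large_numbers_Lipschitz:
  fixes Xs :: "nat \<Rightarrow> 'a \<Rightarrow> 'b::{metric_space, second_countable_topology}"
    and F :: "('b \<Rightarrow> real) set"
  assumes indep: "indep_vars (\<lambda>_. borel) Xs UNIV"
    and distr: "\<And>i. distr M borel (Xs i) = D"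
    and bound: "\<And>f x. f \<in> F \<Longrightarrow> \<bar>f x\<bar> \<le> B"
    and Lip: "\<And>f. f \<in> F \<Longrightarrow> L-lipschitz_on UNIV f"
  shows "AE \<omega> in M. uniform_limit F (\<lambda>n f. (\<Sum>i<n. f (Xs i \<omega>)) / real n)
           (\<lambda>f. \<integral>x. f x \<partial>D) sequentially"
proof -
  have rv [measurable]: "Xs i \<in> borel_measurable M" for i
    using indep unfolding indep_vars_def by auto
  interpret D: prob_space D
    unfolding distr[of 0, symmetric] by (rule prob_space_distr) auto
  have sets_D [measurable_cong]: "sets D = sets borel"
    unfolding distr[of 0, symmetric] by simp
  obtain S :: "nat \<Rightarrow> 'b \<Rightarrow> 'b" where
    simple: "\<And>k. simple_function borel (S k)" and
    S_lim: "\<And>x. (\<lambda>k. S k x) \<longlonglongrightarrow> x"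
    using borel_measurable_implies_sequence_metric[of "\<lambda>x::'b. x" borel undefined] by auto
  have S_meas [measurable]: "S k \<in> borel_measurable borel" for k
    using simple by (rule borel_measurable_simple_function)
  have fin: "finite (range (S k))" for k
    using simple_functionD(1)[OF simple[of k]] by simp
  define d where "d k x = min 1 (dist (S k x) x)" for k x
  have d_meas [measurable]: "d k \<in> borel_measurable borel" for k
    unfolding d_def by measurable
  have d_abs: "\<bar>d k x\<bar> \<le> 1" for k x
    by (simp add: d_def)
  have d_int: "integrable D (d k)" for k
    by (rule D.integrable_const_bound[where B = 1]) (use d_abs in auto)
  have d_lim: "(\<lambda>k. \<integral>x. d k x \<partial>D) \<longlonglongrightarrow> 0"
  proof -
    have "(\<lambda>k. d k x) \<longlonglongrightarrow> min 1 (dist x x)" for x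
      unfolding d_def by (intro tendsto_intros S_lim)
    then have "(\<lambda>k. \<integral>x. d k x \<partial>D) \<longlonglongrightarrow> (\<integral>x. 0 \<partial>D)"
      by (intro integral_dominated_convergence[where w = "\<lambda>_. 1"]) (use d_abs in auto)
    then show ?thesis by simp
  qed
  define I :: "nat \<Rightarrow> 'b \<Rightarrow> 'b \<Rightarrow> real" where "I k y = indicator (S k -` {y})" for k y
  have I_sets: "S k -` {y} \<in> sets borel" for k y
    using measurable_sets[OF S_meas, of "{y}" k] by simp
  have I_meas [measurable]: "I k y \<in> borel_measurable borel" for k y
    unfolding I_def using I_sets by (rule borel_measurable_indicator)
  have I_abs: "\<bar>I k y x\<bar> \<le> 1" for k y x
    by (simp add: I_def indicator_def)
  have I_int: "integrable D (I k y)" for k y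
    by (rule D.integrable_const_bound[where B = 1]) (use I_abs in auto)
  have repr: "f (S k x) = (\<Sum>y\<in>range (S k). f y * I k y x)" for f :: "'b \<Rightarrow> real" and k x
  proof -
    have "(\<Sum>y\<in>range (S k). f y * I k y x) = (\<Sum>y\<in>range (S k). if y = S k x then f y else 0)"
      by (intro sum.cong) (auto simp: I_def indicator_def)
    then show ?thesis
      using fin by simp
  qed
  \<comment> \<open>Within distance 1 the Lipschitz bound applies; beyond it
    \<open>d k x = 1\<close> and two values of \<open>f\<close> differ by at most
    \<open>2 * \<bar>B\<bar>\<close>. One constant serves both cases.\<close>
  define C where "C = 2 * \<bar>B\<bar> + \<bar>L\<bar>"
  have approx: "\<bar>f x - f (S k x)\<bar> \<le> C * d k x" if f: "f \<in> F" for f k x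
  proof (cases "dist (S k x) x \<le> 1")
    case True
    have "\<bar>f x - f (S k x)\<bar> \<le> L * dist (S k x) x"
      using lipschitz_onD[OF Lip[OF f], of x "S k x"] by (simp add: dist_real_def dist_commute)
    also have "\<dots> \<le> C * dist (S k x) x"
      by (intro mult_right_mono) (auto simp: C_def)
    finally show ?thesis using True by (simp add: d_def min_def)
  next
    case False
    then show ?thesis
      using bound[OF f, of x] bound[OF f, of "S k x"] by (simp add: d_def C_def)
  qed
  \<comment> \<open>The three terms bound the replacement of \<open>f\<close> by \<open>f\<close>
    after \<open>S k\<close> in the sample mean, the same replacement in the integral, and the
    deviation of the resulting step function.\<close>
  define E where "E k n \<omega> = C * ((\<Sum>i<n. d k (Xs i \<omega>)) / real n) + C * (\<integral>x. d k x \<partial>D)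
      + (\<Sum>y\<in>range (S k). \<bar>B\<bar> * \<bar>(\<Sum>i<n. I k y (Xs i \<omega>)) / real n - (\<integral>x. I k y x \<partial>D)\<bar>)"
    for k n \<omega>
  have le_E: "\<bar>(\<Sum>i<n. f (Xs i \<omega>)) / real n - (\<integral>x. f x \<partial>D)\<bar> \<le> E k n \<omega>"
    if f: "f \<in> F" for f k n \<omega>
  proof -
    have [measurable]: "f \<in> borel_measurable borel"
      using lipschitz_on_continuous_on[OF Lip[OF f]] by (rule borel_measurable_continuous_onI)
    have f_int: "integrable D f"
      by (rule D.integrable_const_bound[where B = B]) (use bound[OF f] in auto)
    have fS_int: "integrable D (\<lambda>x. f (S k x))"
      by (rule D.integrable_const_bound[where B = B]) (use bound[OF f] in auto)
    have 1: "\<bar>(\<Sum>i<n. f (Xs i \<omega>)) / real n - (\<Sum>i<n. f (S k (Xs i \<omega>))) / real n\<bar>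
        \<le> C * ((\<Sum>i<n. d k (Xs i \<omega>)) / real n)"
    proof -
      have "\<bar>(\<Sum>i<n. f (Xs i \<omega>)) - (\<Sum>i<n. f (S k (Xs i \<omega>)))\<bar> \<le> (\<Sum>i<n. C * d k (Xs i \<omega>))"
        unfolding sum_subtractf[symmetric] by (intro sum_abs[THEN order_trans] sum_mono approx f)
      then show ?thesis
        by (simp add: diff_divide_distrib[symmetric] sum_distrib_left[symmetric] divide_right_mono)
    qed
    have 2: "\<bar>(\<integral>x. f (S k x) \<partial>D) - (\<integral>x. f x \<partial>D)\<bar> \<le> C * (\<integral>x. d k x \<partial>D)"
    proof -
      have "\<bar>(\<integral>x. f (S k x) \<partial>D) - (\<integral>x. f x \<partial>D)\<bar> = \<bar>\<integral>x. f (S k x) - f x \<partial>D\<bar>"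
        using f_int fS_int by simp
      also have "\<dots> \<le> (\<integral>x. \<bar>f (S k x) - f x\<bar> \<partial>D)"
        by (rule integral_abs_bound)
      also have "\<dots> \<le> (\<integral>x. C * d k x \<partial>D)"
        using f_int fS_int d_int approx[OF f]
        by (intro integral_mono) (auto simp: abs_minus_commute)
      finally show ?thesis by simp
    qed
    have 3: "\<bar>(\<Sum>i<n. f (S k (Xs i \<omega>))) / real n - (\<integral>x. f (S k x) \<partial>D)\<bar>
        \<le> (\<Sum>y\<in>range (S k). \<bar>B\<bar> * \<bar>(\<Sum>i<n. I k y (Xs i \<omega>)) / real n - (\<integral>x. I k y x \<partial>D)\<bar>)"
    proof -
      have a: "(\<Sum>i<n. f (S k (Xs i \<omega>))) / real n
          = (\<Sum>y\<in>range (S k). f y * ((\<Sum>i<n. I k y (Xs i \<omega>)) / real n))"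
        unfolding repr[of f]
        by (subst sum.swap) (simp add: sum_divide_distrib sum_distrib_left)
      have b: "(\<integral>x. f (S k x) \<partial>D) = (\<Sum>y\<in>range (S k). f y * (\<integral>x. I k y x \<partial>D))"
        unfolding repr[of f] using I_int by (subst Bochner_Integration.integral_sum) auto
      have "\<bar>f y\<bar> \<le> \<bar>B\<bar>" for y
        using bound[OF f, of y] by linarith
      then show ?thesis
        unfolding a b sum_subtractf[symmetric] right_diff_distrib[symmetric]
        by (intro sum_abs[THEN order_trans] sum_mono) (auto simp: abs_mult intro!: mult_right_mono)
    qed
    show ?thesis
      using 1 2 3 unfolding E_def by linarith
  qed
  have "AE \<omega> in M. \<forall>k. (\<lambda>n. (\<Sum>i<n. d k (Xs i \<omega>)) / real n) \<longlonglongrightarrow> (\<integral>x. d k x \<partial>D)"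
    unfolding AE_all_countable
    by (intro allI strong_law_of_large_numbers_bounded[OF indep distr d_meas d_abs])
  moreover have "AE \<omega> in M. \<forall>k. \<forall>y\<in>range (S k).
      (\<lambda>n. (\<Sum>i<n. I k y (Xs i \<omega>)) / real n) \<longlonglongrightarrow> (\<integral>x. I k y x \<partial>D)"
    unfolding AE_all_countable
    by (intro allI AE_finite_allI fin strong_law_of_large_numbers_bounded[OF indep distr I_meas I_abs])
  ultimately show ?thesis
  proof eventually_elim
    case (elim \<omega>)
    show ?case
    proof (rule uniform_limitI)
      fix e :: real assume e: "e > 0"
      \<comment> \<open>First \<open>k\<close> is fixed, then \<open>n\<close> grows: the indicator
        terms vanish in the limit, and the sample mean of \<open>d k\<close> contributes its
        integral a second time.\<close>
      have "(\<lambda>k. C * (\<integral>x. d k x \<partial>D) + C * (\<integral>x. d k x \<partial>D)) \<longlonglongrightarrow> C * 0 + C * 0"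
        by (intro tendsto_intros d_lim)
      then have "\<forall>\<^sub>F k in sequentially. C * (\<integral>x. d k x \<partial>D) + C * (\<integral>x. d k x \<partial>D) < e"
        using e by (intro order_tendstoD(2)) auto
      then obtain k where k: "C * (\<integral>x. d k x \<partial>D) + C * (\<integral>x. d k x \<partial>D) < e"
        by (auto simp: eventually_sequentially)
      have "(\<lambda>n. E k n \<omega>) \<longlonglongrightarrow> C * (\<integral>x. d k x \<partial>D) + C * (\<integral>x. d k x \<partial>D)
          + (\<Sum>y\<in>range (S k). \<bar>B\<bar> * \<bar>(\<integral>x. I k y x \<partial>D) - (\<integral>x. I k y x \<partial>D)\<bar>)"
        unfolding E_def using elim by (intro tendsto_intros) auto
      then have "\<forall>\<^sub>F n in sequentially. E k n \<omega> < e"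
        using k by (intro order_tendstoD(2)) auto
      then show "\<forall>\<^sub>F n in sequentially. \<forall>f\<in>F.
          dist ((\<Sum>i<n. f (Xs i \<omega>)) / real n) (\<integral>x. f x \<partial>D) < e"
        by eventually_elim (auto simp: dist_real_def intro: le_less_trans[OF le_E])
    qed
  qed
qed

section \<open>Gram determinants and near collinearity\<close>

text \<open>A quantitative form of strict convexity: near equality in the triangle inequality forces
  near collinearity. The Gram determinant factors as a difference of squares; Cauchy-Schwarz bounds
  one factor, and twice the other is
  \<open>(norm a + norm b)\<^sup>2 - (norm (a + b))\<^sup>2\<close>, which factors again.\<close>

lemma gram_le_midpoint_gap:
  fixes a b :: "'a::real_inner"
  shows "(norm a)\<^sup>2 * (norm b)\<^sup>2 - (inner a b)\<^sup>2
    \<le> norm a * norm b * (norm a + norm b + norm (a + b)) * (norm a + norm b - norm (a + b))"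
proof -
  have "(norm a)\<^sup>2 * (norm b)\<^sup>2 - (inner a b)\<^sup>2
      = (norm a * norm b + inner a b) * (norm a * norm b - inner a b)"
    by (simp add: power2_eq_square algebra_simps)
  also have "\<dots> \<le> (2 * (norm a * norm b)) * (norm a * norm b - inner a b)"
    using norm_cauchy_schwarz[of a b] by (intro mult_right_mono) auto
  also have "\<dots> = norm a * norm b * ((norm a + norm b)\<^sup>2 - (norm (a + b))\<^sup>2)"
    unfolding power2_norm_eq_inner[of "a + b"] power2_sum power2_norm_eq_inner
    by (simp add: inner_add inner_commute algebra_simps)
  also have "\<dots> = norm a * norm b * (norm a + norm b + norm (a + b)) * (norm a + norm b - norm (a + b))"
    by (simp add: power2_eq_square algebra_simps)
  finally show ?thesis .
qed

text \<open>The Gram determinant of \<open>c\<close> and \<open>h k\<close>, divided by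
  \<open>(norm c)\<^sup>2\<close>, is the squared distance of \<open>h k\<close> from the line
  spanned by \<open>c\<close>. Thus \<open>h k\<close> approaches two lines that meet only in
  \<open>0\<close>.\<close>

lemma tendsto_zero_if_gram_tendsto_zero:
  fixes a b :: "'a::real_inner" and h :: "nat \<Rightarrow> 'a"
  assumes a: "a \<noteq> 0" and b: "\<And>t. b \<noteq> t *\<^sub>R a"
    and ga: "(\<lambda>k. (norm a)\<^sup>2 * (norm (h k))\<^sup>2 - (inner a (h k))\<^sup>2) \<longlonglongrightarrow> 0"
    and gb: "(\<lambda>k. (norm b)\<^sup>2 * (norm (h k))\<^sup>2 - (inner b (h k))\<^sup>2) \<longlonglongrightarrow> 0"
  shows "h \<longlonglongrightarrow> 0"
proof -
  define r where "r c k = h k - (inner c (h k) / inner c c) *\<^sub>R c" for c k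
  have r: "r c \<longlonglongrightarrow> 0"
    if c: "c \<noteq> 0" and g: "(\<lambda>k. (norm c)\<^sup>2 * (norm (h k))\<^sup>2 - (inner c (h k))\<^sup>2) \<longlonglongrightarrow> 0" for c
  proof -
    have "(norm (r c k))\<^sup>2 = ((norm c)\<^sup>2 * (norm (h k))\<^sup>2 - (inner c (h k))\<^sup>2) / (norm c)\<^sup>2" for k
      using c unfolding r_def power2_norm_eq_inner
      by (simp add: inner_diff inner_commute field_simps power2_eq_square)
    moreover have "(\<lambda>k. ((norm c)\<^sup>2 * (norm (h k))\<^sup>2 - (inner c (h k))\<^sup>2) / (norm c)\<^sup>2)
        \<longlonglongrightarrow> 0 / (norm c)\<^sup>2"
      using c by (intro tendsto_intros g) auto
    ultimately have "(\<lambda>k. (norm (r c k))\<^sup>2) \<longlonglongrightarrow> 0"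
      by simp
    then have "(\<lambda>k. sqrt ((norm (r c k))\<^sup>2)) \<longlonglongrightarrow> sqrt 0"
      by (intro tendsto_intros)
    then show ?thesis
      by (simp add: tendsto_norm_zero_iff)
  qed
  have b0: "b \<noteq> 0"
    using b[of 0] by simp
  \<comment> \<open>The component of \<open>b\<close> orthogonal to \<open>a\<close>. Pairing
    \<open>h k\<close> with \<open>w\<close> removes its part along \<open>a\<close> but keeps
    \<open>s k * inner w w\<close> from its part along \<open>b\<close>, so \<open>s k\<close> can
    be solved for in terms of the two residuals.\<close>
  define w where "w = b - (inner a b / inner a a) *\<^sub>R a"
  have w: "w \<noteq> 0"
    using b by (simp add: w_def)
  have aw: "inner a w = 0"
    using a by (simp add: w_def inner_diff)
  have bw: "inner b w = inner w w"
    using aw by (subst (2) w_def) (simp add: inner_diff)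
  define s where "s k = inner b (h k) / inner b b" for k
  have hs: "h k = r b k + s k *\<^sub>R b" for k
    by (simp add: r_def s_def)
  have s_eq: "s = (\<lambda>k. (inner (r a k) w - inner (r b k) w) / inner w w)"
  proof
    fix k
    have "inner (r a k) w = inner (h k) w"
      using aw by (simp add: r_def inner_diff)
    moreover have "inner (h k) w = inner (r b k) w + s k * inner w w"
      by (subst hs) (simp add: inner_add bw)
    ultimately show "s k = (inner (r a k) w - inner (r b k) w) / inner w w"
      using w by (simp add: field_simps)
  qed
  have "s \<longlonglongrightarrow> (inner 0 w - inner 0 w) / inner w w"
    unfolding s_eq using w by (intro tendsto_intros r a b0 ga gb) auto
  then have "s \<longlonglongrightarrow> 0"
    by simp
  then have "(\<lambda>k. r b k + s k *\<^sub>R b) \<longlonglongrightarrow> 0 + 0 *\<^sub>R b"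
    by (intro tendsto_intros r b0 gb)
  then show ?thesis
    by (simp add: hs[symmetric])
qed

section \<open>Uniform separation of the population median\<close>

text \<open>In infinite dimension the sphere is not compact, so positivity at each single
  \<open>h\<close> would not yield a common \<open>\<delta>\<close>. Instead, a sequence
  \<open>h k\<close> along which the increments become small is shown to tend to \<open>0\<close>,
  against \<open>norm (h k) = e\<close>.\<close>

lemma (in prob_space) spatial_median_well_separated:
  fixes X :: "'a \<Rightarrow> 'b::{real_inner, second_countable_topology}"
  assumes X [measurable]: "X \<in> borel_measurable M"
    and not_m: "AE \<omega> in M. X \<omega> \<noteq> m"
    and not_on_line: "\<And>L. is_line L \<Longrightarrow> \<not> (AE \<omega> in M. X \<omega> \<in> L)"
    and median: "is_spatial_median M X m"
    and e: "e > 0"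
  shows "\<exists>\<delta>>0. \<forall>h. norm h = e \<longrightarrow> \<delta> \<le> (\<integral>\<omega>. norm (m + h - X \<omega>) - norm (m - X \<omega>) \<partial>M)"
proof (rule ccontr)
  assume contr: "\<not> ?thesis"
  define G where "G h = (\<integral>\<omega>. norm (m + h - X \<omega>) - norm (m - X \<omega>) \<partial>M)" for h
  have "\<exists>h. norm h = e \<and> G h < inverse (real (Suc k))" for k
    using contr by (force simp: G_def not_le)
  then obtain h where h: "\<And>k. norm (h k) = e" and Gh: "\<And>k. G (h k) < inverse (real (Suc k))"
    by metis
  have int: "integrable M (\<lambda>\<omega>. norm (x - X \<omega>) - norm (y - X \<omega>))" for x y
  proof (rule integrable_const_bound[where B = "norm (x - y)"])
    have "\<bar>norm (x - X \<omega>) - norm (y - X \<omega>)\<bar> \<le> norm (x - y)" for \<omega>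
      using norm_triangle_ineq3[of "x - X \<omega>" "y - X \<omega>"] by simp
    then show "AE \<omega> in M. norm (norm (x - X \<omega>) - norm (y - X \<omega>)) \<le> norm (x - y)"
      by simp
  qed auto
  have G_nonneg: "0 \<le> G x" for x
  proof -
    \<comment> \<open>Subtracting \<open>norm (0 - X \<omega>)\<close> in both terms writes
      \<open>G x\<close> as a difference of two values of the objective that \<open>m\<close>
      minimizes.\<close>
    have "G x = (\<integral>\<omega>. (norm (m + x - X \<omega>) - norm (0 - X \<omega>)) - (norm (m - X \<omega>) - norm (0 - X \<omega>)) \<partial>M)"
      by (simp add: G_def)
    also have "\<dots> = (\<integral>\<omega>. norm (m + x - X \<omega>) - norm (0 - X \<omega>) \<partial>M)
        - (\<integral>\<omega>. norm (m - X \<omega>) - norm (0 - X \<omega>) \<partial>M)"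
      by (rule Bochner_Integration.integral_diff[OF int int])
    also have "\<dots> \<ge> 0"
      using median by (auto simp: is_spatial_median_def is_arg_min_def not_less)
    finally show ?thesis .
  qed
  \<comment> \<open>The triangle inequality gap of \<open>m - X\<close> and
    \<open>m + h k - X\<close>. Their sum is twice the vector at the midpoint
    \<open>m + h k / 2\<close>, so the mean of the gap is \<open>G (h k) - 2 * G (h k / 2)\<close>,
    at most \<open>G (h k)\<close>.\<close>
  define \<psi> where "\<psi> k \<omega> = norm (m - X \<omega>) + norm (m + h k - X \<omega>)
      - norm ((m - X \<omega>) + (m + h k - X \<omega>))" for k \<omega>
  have \<psi>_nonneg: "0 \<le> \<psi> k \<omega>" for k \<omega>
    unfolding \<psi>_def using norm_triangle_ineq[of "m - X \<omega>" "m + h k - X \<omega>"] by simp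
  have \<psi>_eq: "\<psi> k \<omega> = (norm (m + h k - X \<omega>) - norm (m - X \<omega>))
      - 2 * (norm (m + (1/2) *\<^sub>R h k - X \<omega>) - norm (m - X \<omega>))" for k \<omega>
  proof -
    have "(m - X \<omega>) + (m + h k - X \<omega>) = 2 *\<^sub>R (m + (1/2) *\<^sub>R h k - X \<omega>)"
      by (simp add: algebra_simps scaleR_2)
    then show ?thesis
      by (simp only: \<psi>_def norm_scaleR) simp
  qed
  have \<psi>_int: "integrable M (\<psi> k)" for k
    unfolding \<psi>_eq[abs_def] by (intro Bochner_Integration.integrable_diff integrable_mult_right int)
  have \<psi>_le: "(\<integral>\<omega>. norm (\<psi> k \<omega>) \<partial>M) \<le> inverse (real (Suc k))" for k
  proof -
    have "(\<integral>\<omega>. norm (\<psi> k \<omega>) \<partial>M) = (\<integral>\<omega>. \<psi> k \<omega> \<partial>M)"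
      using \<psi>_nonneg by simp
    also have "\<dots> = G (h k) - 2 * G ((1/2) *\<^sub>R h k)"
      unfolding \<psi>_eq G_def
      by (subst Bochner_Integration.integral_diff[OF int integrable_mult_right[OF int]])
        (simp only: integral_mult_right_zero)
    also have "\<dots> \<le> inverse (real (Suc k))"
      using Gh[of k] G_nonneg[of "(1/2) *\<^sub>R h k"] by linarith
    finally show ?thesis .
  qed
  have "(\<lambda>k. \<integral>\<omega>. norm (\<psi> k \<omega>) \<partial>M) \<longlonglongrightarrow> 0"
    by (rule tendsto_sandwich[OF _ _ tendsto_const LIMSEQ_inverse_real_of_nat])
      (use \<psi>_le in auto)
  then obtain r where lim: "AE \<omega> in M. (\<lambda>k. \<psi> (r k) \<omega>) \<longlonglongrightarrow> 0"
    using tendsto_L1_AE_subseq[where u = \<psi>, OF \<psi>_int] by blast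
  have gram: "(\<lambda>k. (norm (m - X \<omega>))\<^sup>2 * (norm (h (r k)))\<^sup>2 - (inner (m - X \<omega>) (h (r k)))\<^sup>2) \<longlonglongrightarrow> 0"
    if "(\<lambda>k. \<psi> (r k) \<omega>) \<longlonglongrightarrow> 0" for \<omega>
  proof -
    define a where "a = m - X \<omega>"
    \<comment> \<open>Here \<open>K\<close> depends on \<open>\<omega>\<close> but not on
      \<open>k\<close>: it uses \<open>norm b \<le> norm a + e\<close> and
      \<open>norm (a + b) \<le> norm a + (norm a + e)\<close> for
      \<open>b = a + h k\<close>.\<close>
    define K where "K = norm a * (norm a + e) * (2 * (norm a + (norm a + e)))"
    have upper: "(norm a)\<^sup>2 * (norm (h k))\<^sup>2 - (inner a (h k))\<^sup>2 \<le> K * \<psi> k \<omega>" for k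
    proof -
      define b where "b = a + h k"
      have nb: "norm b \<le> norm a + e"
        unfolding b_def using norm_triangle_ineq[of a "h k"] h by simp
      have nab: "norm (a + b) \<le> norm a + (norm a + e)"
        using norm_triangle_ineq[of a b] nb by linarith
      have psi: "\<psi> k \<omega> = norm a + norm b - norm (a + b)"
        by (simp add: \<psi>_def a_def b_def algebra_simps)
      \<comment> \<open>A Gram determinant is unchanged when the first vector is added to the
        second.\<close>
      have "(norm a)\<^sup>2 * (norm (h k))\<^sup>2 - (inner a (h k))\<^sup>2 = (norm a)\<^sup>2 * (norm b)\<^sup>2 - (inner a b)\<^sup>2"
        unfolding b_def power2_norm_eq_inner
        by (simp add: inner_add inner_commute power2_eq_square algebra_simps)
      also have "\<dots> \<le> norm a * norm b * (norm a + norm b + norm (a + b)) * \<psi> k \<omega>"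
        unfolding psi by (rule gram_le_midpoint_gap)
      also have "\<dots> \<le> K * \<psi> k \<omega>"
        unfolding K_def using nb nab \<psi>_nonneg e by (intro mult_right_mono mult_mono) auto
      finally show ?thesis .
    qed
    have lower: "0 \<le> (norm a)\<^sup>2 * (norm (h k))\<^sup>2 - (inner a (h k))\<^sup>2" for k
      using Cauchy_Schwarz_ineq[of a "h k"] by (simp add: power2_norm_eq_inner)
    have "(\<lambda>k. K * \<psi> (r k) \<omega>) \<longlonglongrightarrow> K * 0"
      by (intro tendsto_intros that)
    then have "(\<lambda>k. K * \<psi> (r k) \<omega>) \<longlonglongrightarrow> 0" by simp
    then show ?thesis
      unfolding a_def[symmetric]
      by (rule tendsto_sandwich[OF _ _ tendsto_const, rotated 2]) (use upper lower in auto)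
  qed
  have "AE \<omega> in M. X \<omega> \<noteq> m \<and> (\<lambda>k. \<psi> (r k) \<omega>) \<longlonglongrightarrow> 0"
    using not_m lim by eventually_elim auto
  then have "\<exists>\<omega>. X \<omega> \<noteq> m \<and> (\<lambda>k. \<psi> (r k) \<omega>) \<longlonglongrightarrow> 0"
    using AE_contr by blast
  then obtain \<omega>1 where \<omega>1: "X \<omega>1 \<noteq> m" "(\<lambda>k. \<psi> (r k) \<omega>1) \<longlonglongrightarrow> 0"
    by blast
  \<comment> \<open>The line through \<open>m\<close> and \<open>X \<omega>1\<close>. As it does not
    carry the distribution, some \<open>\<omega>2\<close> with vanishing gaps has its value off
    \<open>L\<close>, making \<open>m - X \<omega>1\<close> and \<open>m - X \<omega>2\<close>
    linearly independent.\<close>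
  define L where "L = range (\<lambda>t. m + t *\<^sub>R (m - X \<omega>1))"
  have "is_line L"
    unfolding is_line_def L_def using \<omega>1(1) by (metis eq_iff_diff_eq_0)
  have "\<not> (AE \<omega> in M. (\<lambda>k. \<psi> (r k) \<omega>) \<longlonglongrightarrow> 0 \<longrightarrow> X \<omega> \<in> L)"
  proof
    assume "AE \<omega> in M. (\<lambda>k. \<psi> (r k) \<omega>) \<longlonglongrightarrow> 0 \<longrightarrow> X \<omega> \<in> L"
    with lim have "AE \<omega> in M. X \<omega> \<in> L"
      by eventually_elim auto
    with not_on_line[OF \<open>is_line L\<close>] show False by contradiction
  qed
  then obtain \<omega>2 where \<omega>2: "X \<omega>2 \<notin> L" "(\<lambda>k. \<psi> (r k) \<omega>2) \<longlonglongrightarrow> 0"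
    by (metis (mono_tags, lifting) AE_I2)
  have "(\<lambda>k. h (r k)) \<longlonglongrightarrow> 0"
  proof (rule tendsto_zero_if_gram_tendsto_zero[OF _ _ gram[OF \<omega>1(2)] gram[OF \<omega>2(2)]])
    show "m - X \<omega>1 \<noteq> 0" using \<omega>1(1) by auto
    show "m - X \<omega>2 \<noteq> t *\<^sub>R (m - X \<omega>1)" for t
    proof
      assume "m - X \<omega>2 = t *\<^sub>R (m - X \<omega>1)"
      then have "X \<omega>2 = m + (- t) *\<^sub>R (m - X \<omega>1)"
        by (simp add: algebra_simps)
      with \<omega>2(1) show False
        unfolding L_def by blast
    qed
  qed
  then have "(\<lambda>k. norm (h (r k))) \<longlonglongrightarrow> 0"
    by (rule tendsto_norm_zero)
  with h e show False
    by (simp add: LIMSEQ_const_iff)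
qed

section \<open>Localization of the empirical median and consistency\<close>

text \<open>If \<open>mh\<close> were outside the open ball, the segment from \<open>m\<close> to
  \<open>mh\<close> would cross the sphere at some \<open>m + h\<close>. By convexity the objective
  there is at most a mean of its values at \<open>m\<close> and at the minimizer \<open>mh\<close>,
  hence at most its value at \<open>m\<close>, against \<open>pos\<close>.\<close>

lemma dist_empirical_spatial_median_less:
  fixes m :: "'a::real_normed_vector"
  assumes n: "n \<ge> 1" and e: "e > 0" and mh: "is_empirical_spatial_median n xs mh"
    and pos: "\<And>h. norm h = e \<Longrightarrow> 0 < (\<Sum>i<n. norm (m + h - xs i) - norm (m - xs i)) / real n"
  shows "norm (mh - m) < e"
proof (rule ccontr)
  assume "\<not> norm (mh - m) < e"
  then have ge: "e \<le> norm (mh - m)" by simp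
  define t where "t = e / norm (mh - m)"
  have t: "0 < t" "t \<le> 1"
    using ge e divide_pos_pos[of e "norm (mh - m)"] divide_le_eq_1_pos[of "norm (mh - m)" e]
    unfolding t_def by linarith+
  define h where "h = t *\<^sub>R (mh - m)"
  have nh: "norm h = e"
    using ge e by (auto simp: h_def t_def)
  have "norm (m + h - xs i) - norm (m - xs i) \<le> t * (norm (mh - xs i) - norm (m - xs i))" for i
  proof -
    have "m + h - xs i = (1 - t) *\<^sub>R (m - xs i) + t *\<^sub>R (mh - xs i)"
      by (simp add: h_def algebra_simps)
    also have "norm \<dots> \<le> (1 - t) * norm (m - xs i) + t * norm (mh - xs i)"
      using t by (intro norm_triangle_le) simp
    finally show ?thesis by (simp add: algebra_simps)
  qed
  then have "(\<Sum>i<n. norm (m + h - xs i) - norm (m - xs i))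
      \<le> t * ((\<Sum>i<n. norm (mh - xs i)) - (\<Sum>i<n. norm (m - xs i)))"
    unfolding sum_subtractf[symmetric] sum_distrib_left by (intro sum_mono)
  also have "\<dots> \<le> 0"
    using mh n t
    by (auto simp: is_empirical_spatial_median_def is_arg_min_def not_less divide_le_cancel
        intro!: mult_nonneg_nonpos)
  finally show False
    using pos[OF nh] n by (simp add: zero_less_divide_iff)
qed

theorem theorem4p2p2:
  fixes P :: "'p measure"
    and X :: "'p \<Rightarrow> 'a::{real_inner, banach, second_countable_topology}"
    and M :: "'w measure"
    and Xs :: "nat \<Rightarrow> 'w \<Rightarrow> 'a"
    and m :: 'a
    and mhat :: "nat \<Rightarrow> 'w \<Rightarrow> 'a"
  assumes "prob_space P"
    and "X \<in> borel_measurable P"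
    and nonatomic: "\<And>x. measure P {\<omega> \<in> space P. X \<omega> = x} = 0"
    and not_on_line: "\<And>L. is_line L \<Longrightarrow> \<not> (AE \<omega> in P. X \<omega> \<in> L)"
    and inverse_moment:
      "\<And>R::real. R > 0 \<Longrightarrow>
         (SUP x\<in>{x. norm x \<le> R}. \<integral>\<^sup>+\<omega>. inverse (ennreal (norm (x - X \<omega>))) \<partial>P) < \<infinity>"
    and "prob_space M"
    and indep: "prob_space.indep_vars M (\<lambda>_. borel) Xs UNIV"
    and ident_distr: "\<And>i. distr M borel (Xs i) = distr P borel X"
    and median: "is_spatial_median P X m"
    and empirical_median:
      "\<And>n \<omega>. n \<ge> 1 \<Longrightarrow> \<omega> \<in> space M \<Longrightarrow>
         is_empirical_spatial_median n (\<lambda>i. Xs i \<omega>) (mhat n \<omega>)"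
  shows "AE \<omega> in M. (\<lambda>n. norm (mhat n \<omega> - m)) \<longlonglongrightarrow> 0"
proof -
  interpret P: prob_space P by fact
  interpret M: prob_space M by fact
  note X [measurable] = \<open>X \<in> borel_measurable P\<close>
  define f where "f h x = norm (m + h - x) - norm (m - x)" for h x :: 'a
  have f_meas [measurable]: "f h \<in> borel_measurable borel" for h
    unfolding f_def by measurable
  have not_m: "AE \<omega> in P. X \<omega> \<noteq> m"
    using nonatomic[of m] by (subst AE_iff_measurable[OF _ refl]) (auto simp: P.emeasure_eq_measure)
  have close: "AE \<omega> in M. \<forall>\<^sub>F n in sequentially. norm (mhat n \<omega> - m) < e" if e: "e > 0" for e :: real
  proof -
    obtain \<delta> where \<delta>: "\<delta> > 0" and sep: "\<And>h. norm h = e \<Longrightarrow> \<delta> \<le> (\<integral>\<omega>. f h (X \<omega>) \<partial>P)"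
      using P.spatial_median_well_separated[OF X not_m not_on_line median e] by (auto simp: f_def)
    have bound: "\<bar>f h x\<bar> \<le> e" if "norm h = e" for h x
      using norm_triangle_ineq3[of "m + h - x" "m - x"] that by (simp add: f_def)
    have Lip: "2-lipschitz_on UNIV (f h)" for h
    proof (rule lipschitz_onI)
      fix x y :: 'a
      have "\<bar>norm (m + h - x) - norm (m + h - y)\<bar> \<le> norm (x - y)"
        using norm_triangle_ineq3[of "m + h - x" "m + h - y"] by (simp add: norm_minus_commute)
      moreover have "\<bar>norm (m - x) - norm (m - y)\<bar> \<le> norm (x - y)"
        using norm_triangle_ineq3[of "m - x" "m - y"] by (simp add: norm_minus_commute)
      ultimately show "dist (f h x) (f h y) \<le> 2 * dist x y"
        by (simp add: f_def dist_norm)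
    qed simp
    \<comment> \<open>Uniformity over the sphere matters because the direction of
      \<open>mhat n \<omega> - m\<close> is random and varies with \<open>n\<close>; a null set for
      each \<open>h\<close> would not suffice.\<close>
    have "AE \<omega> in M. uniform_limit (f ` {h. norm h = e}) (\<lambda>n f. (\<Sum>i<n. f (Xs i \<omega>)) / real n)
        (\<lambda>f. \<integral>x. f x \<partial>(distr P borel X)) sequentially"
      by (rule M.uniform_law_of_large_numbers_Lipschitz[OF indep ident_distr, where B = e and L = 2])
        (use bound Lip in auto)
    with AE_space show ?thesis
    proof eventually_elim
      case (elim \<omega>)
      have "\<forall>\<^sub>F n in sequentially. \<forall>f\<in>f ` {h. norm h = e}.
          dist ((\<Sum>i<n. f (Xs i \<omega>)) / real n) (\<integral>x. f x \<partial>(distr P borel X)) < \<delta>"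
        using elim(2) \<delta> by (rule uniform_limitD)
      with eventually_ge_at_top[of 1] show ?case
      proof eventually_elim
        case (elim n)
        \<comment> \<open>The population increment is at least \<open>\<delta>\<close> and the
          sample increment deviates from it by less than \<open>\<delta>\<close>.\<close>
        have "0 < (\<Sum>i<n. f h (Xs i \<omega>)) / real n" if h: "norm h = e" for h
        proof -
          have "\<bar>(\<Sum>i<n. f h (Xs i \<omega>)) / real n - (\<integral>\<omega>. f h (X \<omega>) \<partial>P)\<bar> < \<delta>"
            using elim(2) h by (auto simp: dist_real_def integral_distr)
          with sep[OF h] show ?thesis by linarith
        qed
        then show ?case
          using elim(1) \<open>\<omega> \<in> space M\<close> e
          by (intro dist_empirical_spatial_median_less[OF _ _ empirical_median]) (auto simp: f_def)
      qed
    qed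
  qed
  show ?thesis
    by (rule AE_tendstoI) (simp add: close)
qed

end
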